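(* Let $H=(V,F)$ be a finite hypergraph and let $\mathcal M$ be the $\vec E\times\vec E$ matrix with $\mathcal M_{e,e'}=1$ if $e\rightharpoonup e'$ and $0$ otherwise. Then $$\det\mathcal M=\prod_{i\in V}(1-d_i)\prod_{\alpha\in F}(1-d_\alpha).$$
   Context: A hypergraph $H=(V,F)$: finite vertex set $V$, finite collection $F$ of nonempty subsets of $V$ (factors); $d_i=|\{\alpha\in F:i\in\alpha\}|$, $d_\alpha=|\alpha|$. Directed edges $\vec E=\{(\alpha\to i):\alpha\in F,i\in\alpha\}$, $s(\alpha\to i)=\alpha$, $t(\alpha\to i)=i$. For $e,e'\in\vec E$, $e\rightharpoonup e'$ means $t(e)\in s(e')$, $t(e)\neq t(e')$ and $s(e)\ne s(e')$. *)

theory Defs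
  imports "Jordan_Normal_Form.Determinant"
begin

definition finite_hypergraph :: "'v set \<Rightarrow> 'v set set \<Rightarrow> bool" where
  "finite_hypergraph V F \<longleftrightarrow> finite V \<and> finite F \<and> (\<forall>\<alpha>\<in>F. \<alpha> \<noteq> {} \<and> \<alpha> \<subseteq> V)"

definition vertex_degree :: "'v set set \<Rightarrow> 'v \<Rightarrow> nat" where
  "vertex_degree F i = card {\<alpha> \<in> F. i \<in> \<alpha>}"

definition factor_degree :: "'v set \<Rightarrow> nat" where
  "factor_degree \<alpha> = card \<alpha>"

text \<open>The directed edge from a factor \<open>\<alpha>\<close> to a vertex \<open>i\<close> is the pair \<open>(\<alpha>, i)\<close>.\<close>

type_synonym 'v dedge = "'v set \<times> 'v"

definition directed_edges :: "'v set set \<Rightarrow> 'v dedge set" where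
  "directed_edges F = {(\<alpha>, i). \<alpha> \<in> F \<and> i \<in> \<alpha>}"

definition source :: "'v dedge \<Rightarrow> 'v set" where
  "source e = fst e"

definition target :: "'v dedge \<Rightarrow> 'v" where
  "target e = snd e"

definition edge_step :: "'v dedge \<Rightarrow> 'v dedge \<Rightarrow> bool" where
  "edge_step e e' \<longleftrightarrow>
     target e \<in> source e' \<and> target e \<noteq> target e' \<and> source e \<noteq> source e'"

definition edge_entry :: "'v dedge \<Rightarrow> 'v dedge \<Rightarrow> int" where
  "edge_entry e e' = (if edge_step e e' then 1 else 0)"

text \<open>Library matrices are indexed by \<open>{0..<n}\<close>, so a matrix whose rows and columns are both
  indexed by a finite set is written down along a duplicate-free enumeration of that set.
  Its determinant does not depend on the enumeration.\<close>

definition mat_along :: "'e list \<Rightarrow> ('e \<Rightarrow> 'e \<Rightarrow> 'a) \<Rightarrow> 'a mat" where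
  "mat_along es M = mat (length es) (length es) (\<lambda>(k, l). M (es ! k) (es ! l))"

end

theory Submission
  imports Defs
begin

text \<open>A step \<open>(\<alpha>, i) \<rightharpoonup> (\<beta>, j)\<close> factors uniquely through the edge
  \<open>(\<beta>, i)\<close>: first the factor is changed with the vertex kept, then the vertex with the factor
  kept. So the matrix is a product \<open>(I - C) (I - D)\<close>, where \<open>C\<close> and \<open>D\<close> are the indicator
  matrices of the relations ``same target'' and ``same source''. Each of these is \<open>U U\<^sup>T\<close> with \<open>U\<close>
  the incidence matrix between edges and classes, and Sylvester's identity
  \<open>det (I - U U\<^sup>T) = det (I - U\<^sup>T U)\<close> leaves a diagonal matrix of class sizes.\<close>

text \<open>Sylvester's identity: the block matrix with rows \<open>1, A\<close> and
  \<open>B, 1\<close> is eliminated in two ways, as \<open>?X * ?L\<close> and as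
  \<open>?L * ?Y\<close>. Here \<open>?L\<close> is unipotent lower triangular, so it contributes
  determinant 1, while \<open>?X\<close> and \<open>?Y\<close> are block upper triangular and carry
  the two sides.\<close>

lemma det_one_minus_mult_commute:
  fixes A :: "'a::idom mat"
  assumes A: "A \<in> carrier_mat n m" and B: "B \<in> carrier_mat m n"
  shows "det (1\<^sub>m n - A * B) = det (1\<^sub>m m - B * A)"
proof -
  let ?L = "four_block_mat (1\<^sub>m n) (0\<^sub>m n m) B (1\<^sub>m m)"
  let ?X = "four_block_mat (1\<^sub>m n - A * B) A (0\<^sub>m m n) (1\<^sub>m m)"
  let ?Y = "four_block_mat (1\<^sub>m n) A (0\<^sub>m m n) (1\<^sub>m m - B * A)"
  have AB: "1\<^sub>m n - A * B \<in> carrier_mat n n" and BA: "1\<^sub>m m - B * A \<in> carrier_mat m m"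
    using A B by (auto intro!: minus_carrier_mat)
  have cancel_AB: "1\<^sub>m n - A * B + A * B = 1\<^sub>m n" and cancel_BA: "B * A + (1\<^sub>m m - B * A) = 1\<^sub>m m"
    using A B by (auto intro!: eq_matI)
  have "?X * ?L = four_block_mat (1\<^sub>m n) A B (1\<^sub>m m)"
    using A B AB by (subst mult_four_block_mat[of _ n n _ m _ m _ _ n _ m]) (auto simp: cancel_AB)
  moreover have "?L * ?Y = four_block_mat (1\<^sub>m n) A B (1\<^sub>m m)"
    using A B BA by (subst mult_four_block_mat[of _ n n _ m _ m _ _ n _ m]) (auto simp: cancel_BA)
  ultimately have "det (?X * ?L) = det (?L * ?Y)"
    by simp
  moreover have "det (?X * ?L) = det ?X * det ?L"
    using AB by (intro det_mult[of _ "n + m"]) auto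
  moreover have "det (?L * ?Y) = det ?L * det ?Y"
    using BA by (intro det_mult[of _ "n + m"]) auto
  moreover have "det ?L = 1"
    using B by (subst det_four_block_mat_upper_right_zero[of _ n _ m]) auto
  moreover have "det ?X = det (1\<^sub>m n - A * B)"
    using A AB by (subst det_four_block_mat_lower_left_zero[of _ n _ m]) auto
  moreover have "det ?Y = det (1\<^sub>m m - B * A)"
    using A BA by (subst det_four_block_mat_lower_left_zero[of _ n _ m]) auto
  ultimately show ?thesis
    by simp
qed

lemma sum_nth_distinct:
  "distinct xs \<Longrightarrow> (\<Sum>l = 0..<length xs. f (xs ! l)) = sum f (set xs)"
  by (intro sum.reindex_bij_betw bij_betw_nth) (auto simp: atLeast0LessThan)

lemma prod_nth_distinct:
  "distinct xs \<Longrightarrow> (\<Prod>l = 0..<length xs. f (xs ! l)) = prod f (set xs)"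
  by (intro prod.reindex_bij_betw bij_betw_nth) (auto simp: atLeast0LessThan)

lemma mat_along_carrier [simp]: "mat_along es M \<in> carrier_mat (length es) (length es)"
  by (simp add: mat_along_def)

lemma mat_along_mult:
  assumes "distinct es"
  shows "mat_along es M * mat_along es N =
    mat_along es (\<lambda>e e'. \<Sum>f\<in>set es. M e f * N f e')"
  by (rule eq_matI)
    (auto simp: mat_along_def scalar_prod_def sum_nth_distinct[OF assms, symmetric])

text \<open>Letting \<open>K\<close> exceed the image of \<open>c\<close> is harmless, since a label
  with an empty class contributes the factor 1 - 0. This allows \<open>K\<close> to be all of
  \<open>V\<close>, isolated vertices included.\<close>

lemma det_identity_minus_same_class:
  fixes c :: "'e \<Rightarrow> 'k"
  assumes es: "distinct es" and K: "finite K" "c ` set es \<subseteq> K"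
  shows "det (mat_along es (\<lambda>e f. of_bool (e = f) - of_bool (c e = c f)) :: 'a::idom mat) =
    (\<Prod>k\<in>K. 1 - of_nat (card {e \<in> set es. c e = k}))"
proof -
  obtain ks where ks: "set ks = K" "distinct ks"
    using finite_distinct_list[OF K(1)] by blast
  let ?n = "length es" and ?m = "length ks"
  define U :: "'a mat" where "U = mat ?n ?m (\<lambda>(a, b). of_bool (c (es ! a) = ks ! b))"
  define U' :: "'a mat" where "U' = mat ?m ?n (\<lambda>(b, a). of_bool (c (es ! a) = ks ! b))"
  have U: "U \<in> carrier_mat ?n ?m" "U' \<in> carrier_mat ?m ?n"
    by (auto simp: U_def U'_def)
  have UU': "mat_along es (\<lambda>e f. of_bool (e = f) - of_bool (c e = c f)) = 1\<^sub>m ?n - U * U'"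
  proof (rule eq_matI)
    fix a a' assume "a < dim_row (1\<^sub>m ?n - U * U')" "a' < dim_col (1\<^sub>m ?n - U * U')"
    then have a: "a < ?n" "a' < ?n"
      using U by auto
    have "(U * U') $$ (a, a') =
        (\<Sum>b = 0..<?m. of_bool (c (es ! a) = ks ! b) * of_bool (c (es ! a') = ks ! b))"
      using a by (auto simp: U_def U'_def scalar_prod_def intro!: sum.cong)
    also have "\<dots> = (\<Sum>k\<in>K. of_bool (c (es ! a) = k) * of_bool (c (es ! a') = k))"
      using sum_nth_distinct[OF ks(2), of "\<lambda>k. of_bool (c (es ! a) = k) * of_bool (c (es ! a') = k)"]
      unfolding ks(1) .
    also have "\<dots> = (\<Sum>k\<in>K. if c (es ! a) = k then of_bool (c (es ! a') = k) else 0)"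
      by (intro sum.cong) auto
    \<comment> \<open>The only surviving label is \<open>c (es ! a)\<close>, which belongs to
      \<open>K\<close> because \<open>K\<close> contains the image of \<open>c\<close>.\<close>
    also have "\<dots> = of_bool (c (es ! a) = c (es ! a'))"
      using K a by (auto simp: sum.delta')
    finally show "mat_along es (\<lambda>e f. of_bool (e = f) - of_bool (c e = c f)) $$ (a, a') =
        (1\<^sub>m ?n - U * U') $$ (a, a')"
      using a U es by (simp add: mat_along_def nth_eq_iff_index_eq)
  qed (use U in \<open>auto simp: mat_along_def\<close>)
  have U'U: "1\<^sub>m ?m - U' * U =
      mat ?m ?m (\<lambda>(b, b'). of_bool (b = b') * (1 - of_nat (card {e \<in> set es. c e = ks ! b})))"
  proof (rule eq_matI)
    fix b b' assume "b < dim_row (mat ?m ?m (\<lambda>(b, b'). of_bool (b = b') *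
        (1 - of_nat (card {e \<in> set es. c e = ks ! b})) :: 'a))"
      "b' < dim_col (mat ?m ?m (\<lambda>(b, b'). of_bool (b = b') *
        (1 - of_nat (card {e \<in> set es. c e = ks ! b})) :: 'a))"
    then have b: "b < ?m" "b' < ?m"
      by auto
    have "(U' * U) $$ (b, b') =
        (\<Sum>a = 0..<?n. of_bool (c (es ! a) = ks ! b) * of_bool (c (es ! a) = ks ! b'))"
      using b by (auto simp: U_def U'_def scalar_prod_def intro!: sum.cong)
    also have "\<dots> = (\<Sum>e\<in>set es. of_bool (c e = ks ! b) * of_bool (c e = ks ! b'))"
      using sum_nth_distinct[OF es, of "\<lambda>e. of_bool (c e = ks ! b) * of_bool (c e = ks ! b')"] .
    \<comment> \<open>No edge lies in two classes, and distinct indices name distinct labels, so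
      everything off the diagonal vanishes.\<close>
    also have "\<dots> = (\<Sum>e\<in>set es. of_bool (b = b') * of_bool (c e = ks ! b))"
      using b ks(2) by (intro sum.cong) (auto simp: nth_eq_iff_index_eq)
    also have "\<dots> = of_bool (b = b') * of_nat (card {e \<in> set es. c e = ks ! b})"
      by (simp flip: sum_distrib_left add: Int_def)
    finally show "(1\<^sub>m ?m - U' * U) $$ (b, b') = mat ?m ?m (\<lambda>(b, b'). of_bool (b = b') *
        (1 - of_nat (card {e \<in> set es. c e = ks ! b}))) $$ (b, b')"
      using b U by auto
  qed (use U in auto)
  have "det (mat_along es (\<lambda>e f. of_bool (e = f) - of_bool (c e = c f)) :: 'a mat) =
      det (1\<^sub>m ?m - U' * U)"
    unfolding UU' by (rule det_one_minus_mult_commute[OF U])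
  also have "\<dots> = (\<Prod>b = 0..<?m. 1 - of_nat (card {e \<in> set es. c e = ks ! b}))"
    unfolding U'U by (subst det_upper_triangular[of _ ?m]) (auto simp: prod_list_diag_prod)
  also have "\<dots> = (\<Prod>k\<in>K. 1 - of_nat (card {e \<in> set es. c e = k}))"
    using prod_nth_distinct[OF ks(2), of "\<lambda>k. 1 - of_nat (card {e \<in> set es. c e = k})"]
    unfolding ks(1) .
  finally show ?thesis .
qed

text \<open>Each bracket is 0 or -1: the first is -1 when \<open>f\<close> differs from
  \<open>e\<close> but has the same target, the second when \<open>f\<close> differs from
  \<open>e'\<close> but has the same source. The two signs cancel, and both conditions together
  force \<open>f\<close> to be (source of \<open>e'\<close>, target of \<open>e\<close>).\<close>

lemma edge_entry_eq_sum:
  assumes fin: "finite (directed_edges F)"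
    and e: "e \<in> directed_edges F" and e': "e' \<in> directed_edges F"
  shows "edge_entry e e' = (\<Sum>f\<in>directed_edges F.
    (of_bool (e = f) - of_bool (target e = target f)) *
    (of_bool (f = e') - of_bool (source f = source e')))"
proof -
  obtain \<alpha> i \<beta> j where eq: "e = (\<alpha>, i)" "e' = (\<beta>, j)"
    by (meson surj_pair)
  have through: "(of_bool (e = f) - of_bool (target e = target f)) *
      (of_bool (f = e') - of_bool (source f = source e')) =
      (if f = (\<beta>, i) then of_bool (i \<noteq> j \<and> \<alpha> \<noteq> \<beta>) else 0 :: int)" for f
    by (cases f) (simp add: eq source_def target_def of_bool_def)
  \<comment> \<open>Whether the intermediate pair is an edge at all is exactly the remaining
    condition of \<open>edge_step\<close>, that the target of \<open>e\<close> lies in the source of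
    \<open>e'\<close>.\<close>
  have "(\<beta>, i) \<in> directed_edges F \<longleftrightarrow> i \<in> \<beta>"
    using e' by (simp add: eq directed_edges_def)
  then show ?thesis
    unfolding through using fin
    by (simp add: eq edge_entry_def edge_step_def source_def target_def)
qed

theorem theorem3p8:
  fixes V :: "'v set" and F :: "'v set set" and es :: "'v dedge list"
  assumes "finite_hypergraph V F"
    and "distinct es" and "set es = directed_edges F"
  shows "det (mat_along es edge_entry) =
    (\<Prod>i\<in>V. 1 - int (vertex_degree F i)) * (\<Prod>\<alpha>\<in>F. 1 - int (factor_degree \<alpha>))"
proof -
  let ?A = "mat_along es (\<lambda>e f. of_bool (e = f) - of_bool (target e = target f)) :: int mat"
  let ?B = "mat_along es (\<lambda>e f. of_bool (e = f) - of_bool (source e = source f)) :: int mat"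
  have V: "finite V" "target ` set es \<subseteq> V" and F: "finite F" "source ` set es \<subseteq> F"
    using assms by (fastforce simp: finite_hypergraph_def directed_edges_def source_def target_def)+
  have fin: "finite (directed_edges F)"
    using assms(3) by (metis List.finite_set)
  have "mat_along es edge_entry = ?A * ?B"
    unfolding mat_along_mult[OF assms(2)] assms(3)
    by (rule eq_matI)
      (simp_all add: mat_along_def edge_entry_eq_sum[OF fin] flip: assms(3))
  then have "det (mat_along es edge_entry) = det ?A * det ?B"
    using det_mult[of ?A "length es" ?B] by simp
  moreover have "card {e \<in> set es. target e = i} = vertex_degree F i" for i
  proof -
    have "{e \<in> set es. target e = i} = (\<lambda>\<alpha>. (\<alpha>, i)) ` {\<alpha> \<in> F. i \<in> \<alpha>}"
      by (auto simp: assms(3) directed_edges_def target_def)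
    then show ?thesis
      by (simp add: vertex_degree_def card_image inj_on_def)
  qed
  \<comment> \<open>Unlike the count by target, this one is restricted: a set outside
    \<open>F\<close> is the source of no edge, whatever its size.\<close>
  moreover have "card {e \<in> set es. source e = \<alpha>} = factor_degree \<alpha>" if "\<alpha> \<in> F" for \<alpha>
  proof -
    have "{e \<in> set es. source e = \<alpha>} = Pair \<alpha> ` \<alpha>"
      using that by (auto simp: assms(3) directed_edges_def source_def)
    then show ?thesis
      by (simp add: factor_degree_def card_image inj_on_def)
  qed
  ultimately show ?thesis
    using det_identity_minus_same_class[OF assms(2) V, where 'a = int]
      det_identity_minus_same_class[OF assms(2) F, where 'a = int]
    by simp
qed

end
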